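(* Let $T$ be a strong semicomplete digraph on $t\ge 2$ vertices and let $H_1,\dots,H_t$ be arbitrary digraphs, each with at least two vertices. Then $Q=T[H_1,\dots,H_t]$ has a good decomposition if and only if $Q$ is not isomorphic to any of the three digraphs $\overrightarrow{C}_3[\overline{K_2},\overline{K_2},\overline{K_2}]$, $\overrightarrow{C}_3[\overrightarrow{P}_2,\overline{K_2},\overline{K_2}]$, $\overrightarrow{C}_3[\overline{K_2},\overline{K_2},\overline{K_3}]$.
   Context: All digraphs are finite, without loops or parallel arcs. A digraph is strong if for every ordered pair of distinct vertices $x,y$ there is a directed path from $x$ to $y$. A digraph is semicomplete if there is at least one arc between every pair of distinct vertices. A digraph $D=(V,A)$ has a good decomposition if $A$ contains two disjoint sets $A_1,A_2$ with both $(V,A_1)$ and $(V,A_2)$ strong. $\overline{K_p}$ is the digraph on $p$ vertices with no arcs; $\overrightarrow{C}_k$ is the directed cycle on $k$ vertices; $\overrightarrow{P}_k$ is the directed path on $k$ vertices (so $\overrightarrow{P}_2$ is two vertices with one arc). Composition: if $T$ has vertices $u_1,\dots,u_t$ and $H_i$ has vertices $u_{i,1},\dots,u_{i,n_i}$, then $T[H_1,\dots,H_t]$ has vertex set $\{u_{i,j}\}$ and arc set $\bigcup_{i} A(H_i)\cup\{u_{i,j}u_{p,q}: u_iu_p\in A(T)\}$ (all $j,q$). *)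

theory Defs
  imports "Graph_Theory.Graph_Theory"
begin

text \<open>
  Digraphs without parallel arcs are pair digraphs; the locale \<^locale>\<open>pair_digraph\<close> adds
  well-formedness, finiteness and the absence of loops. Strong connectivity and isomorphism
  are the notions of the library, applied along \<^const>\<open>with_proj\<close>.
\<close>

definition semicomplete :: "'a pair_pre_digraph \<Rightarrow> bool" where
  "semicomplete D \<longleftrightarrow>
     (\<forall>u \<in> pverts D. \<forall>v \<in> pverts D. u \<noteq> v \<longrightarrow> (u, v) \<in> parcs D \<or> (v, u) \<in> parcs D)"

definition good_decomposition :: "'a pair_pre_digraph \<Rightarrow> bool" where
  "good_decomposition D \<longleftrightarrow>
     (\<exists>A1 A2. A1 \<subseteq> parcs D \<and> A2 \<subseteq> parcs D \<and> A1 \<inter> A2 = {} \<and>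
        strongly_connected (with_proj \<lparr>pverts = pverts D, parcs = A1\<rparr>) \<and>
        strongly_connected (with_proj \<lparr>pverts = pverts D, parcs = A2\<rparr>))"

text \<open>
  The composition T[H], where the digraph substituted for the vertex u of T is H u.
  The pair (u, x) is the copy of the vertex x of H u.
\<close>
definition composition ::
  "'a pair_pre_digraph \<Rightarrow> ('a \<Rightarrow> 'b pair_pre_digraph) \<Rightarrow> ('a \<times> 'b) pair_pre_digraph" where
  "composition T H =
     \<lparr>pverts = (SIGMA u : pverts T. pverts (H u)),
      parcs = (\<Union>u \<in> pverts T. {((u, x), (u, y)) | x y. (x, y) \<in> parcs (H u)}) \<union>
              {((u, x), (v, y)) | u x v y.
                 (u, v) \<in> parcs T \<and> x \<in> pverts (H u) \<and> y \<in> pverts (H v)}\<rparr>"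

definition arcless :: "nat \<Rightarrow> nat pair_pre_digraph" where
  "arcless p = \<lparr>pverts = {..<p}, parcs = {}\<rparr>"

text \<open>A directed cycle only for k at least 2; the case k = 1 is a loop.\<close>
definition dicycle :: "nat \<Rightarrow> nat pair_pre_digraph" where
  "dicycle k = \<lparr>pverts = {..<k}, parcs = {(i, Suc i mod k) | i. i < k}\<rparr>"

definition dipath :: "nat \<Rightarrow> nat pair_pre_digraph" where
  "dipath k = \<lparr>pverts = {..<k}, parcs = {(i, Suc i) | i. Suc i < k}\<rparr>"

end

theory Submission
  imports Defs
begin

text \<open>
  A good decomposition pulls back along every surjective arc-reflecting vertex map, so it
  suffices to decompose small digraphs, and a closed spanning walk certifies that its arcs
  form a strong digraph. In a composition whose parts have at least two vertices, distinguish
  one vertex of each part. Around a cycle of T of even length k the two resulting classes per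
  part carry two arc-disjoint Hamiltonian cycles of length 2 k: at each arc of T one of them
  keeps the class where the other changes it, and each must change class an odd number of
  times, which is possible because k is even. Such a decomposition extends to all parts, since
  T is strong. A strong semicomplete digraph without cycles of length 2 and 4 is the directed
  triangle. There seven explicit decompositions cover everything except the three exceptions,
  where for every choice of two disjoint arc sets one of them misses a cut.
\<close>

section \<open>Strong digraphs and decompositions\<close>

definition strong :: "'a set \<Rightarrow> 'a rel \<Rightarrow> bool" where
  "strong V A \<longleftrightarrow> V \<noteq> {} \<and> (\<forall>x \<in> V. \<forall>y \<in> V. (x, y) \<in> A\<^sup>*)"

text \<open>Intersecting with \<open>V \<times> V\<close> allows one ambient arc set for several
  vertex sets: below, \<open>E\<close> stays fixed while the vertex set grows from
  \<open>blow S\<close> to \<open>blow (pverts T)\<close>.\<close>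

definition splits :: "'a set \<Rightarrow> 'a rel \<Rightarrow> bool" where
  "splits V E \<longleftrightarrow>
     (\<exists>A B. A \<subseteq> E \<inter> V \<times> V \<and> B \<subseteq> E \<inter> V \<times> V \<and> A \<inter> B = {} \<and> strong V A \<and> strong V B)"

lemma strongly_connected_iff_strong:
  assumes "A \<subseteq> V \<times> V"
  shows "strongly_connected (with_proj \<lparr>pverts = V, parcs = A\<rparr>) \<longleftrightarrow> strong V A"
proof -
  have "(x, y) \<in> rtrancl_on V A \<longleftrightarrow> (x, y) \<in> A\<^sup>*" if "x \<in> V" for x y
  proof
    show "(x, y) \<in> A\<^sup>*" if "(x, y) \<in> rtrancl_on V A"
      using that by (rule rtrancl_on_rtranclI)
    show "(x, y) \<in> rtrancl_on V A" if "(x, y) \<in> A\<^sup>*"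
      using that
    proof induction
      case (step y z)
      then show ?case
        using assms by (blast intro: rtrancl_on_into_rtrancl_on)
    qed (use \<open>x \<in> V\<close> in simp)
  qed
  then show ?thesis
    by (simp add: strongly_connected_def strong_def reachable_def)
qed

lemma good_decomposition_iff_splits:
  assumes "parcs D \<subseteq> pverts D \<times> pverts D"
  shows "good_decomposition D \<longleftrightarrow> splits (pverts D) (parcs D)"
proof -
  let ?V = "pverts D"
  have sub: "A \<subseteq> parcs D \<inter> ?V \<times> ?V \<longleftrightarrow> A \<subseteq> parcs D" for A
    using assms by (simp add: Int_absorb2)
  have str: "strongly_connected (with_proj \<lparr>pverts = ?V, parcs = A\<rparr>) \<longleftrightarrow> strong ?V A"
    if "A \<subseteq> parcs D" for A
    using that assms by (intro strongly_connected_iff_strong) (rule subset_trans)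
  show ?thesis
    unfolding good_decomposition_def splits_def sub
    by (intro ex_cong1 conj_cong refl) (simp_all only: str)
qed

lemma splits_mono:
  assumes "splits V E" "E \<subseteq> F"
  shows "splits V F"
proof -
  have "E \<inter> V \<times> V \<subseteq> F \<inter> V \<times> V"
    using assms(2) by blast
  then show ?thesis
    using assms(1) unfolding splits_def by (meson subset_trans)
qed

text \<open>A set without leaving arcs is closed under reachability, so it cannot miss a vertex
  reachable from one of its members.\<close>

lemma strong_cut:
  assumes "strong V A" "A \<subseteq> V \<times> V" "S \<subseteq> V" "S \<noteq> {}" "S \<noteq> V"
  shows "\<exists>(u, v) \<in> A. u \<in> S \<and> v \<in> V - S"
proof (rule ccontr)
  assume no: "\<not> ?thesis"
  obtain s v where s: "s \<in> S" and v: "v \<in> V" "v \<notin> S"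
    using assms(3-5) by blast
  have "(s, v) \<in> A\<^sup>*"
    using assms(1,3) s v(1) by (auto simp: strong_def)
  then have "v \<in> S"
  proof induction
    case (step y z)
    then have "z \<in> V"
      using assms(2) by blast
    then show ?case
      using no step(2,3) by auto
  qed (rule s)
  then show False
    using v by blast
qed

text \<open>A walk of positive length lifts to any preimages of its two ends, since its inner
  vertices have preimages too. Length zero would not do: two vertices of one fibre must be joined by
  lifting a closed walk of positive length, and this exists because \<open>W\<close> has two
  distinct vertices.\<close>

lemma strong_pullback:
  assumes W: "strong W B" and img: "f ` V = W" and pq: "p \<in> W" "q \<in> W" "p \<noteq> q"
    and B: "B \<subseteq> W \<times> W"
  shows "strong V {(v, w) \<in> V \<times> V. (f v, f w) \<in> B}" (is "strong V ?A")
proof -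
  have step: "(v, w) \<in> ?A\<^sup>+" if "(x, y) \<in> B\<^sup>+" "v \<in> V" "f v = x" "w \<in> V" "f w = y" for x y v w
    using that(1,4,5)
  proof (induction arbitrary: w)
    case (base y)
    then show ?case
      using that(2,3) by (intro r_into_trancl) auto
  next
    case (step y z)
    then have "y \<in> f ` V"
      using img B by blast
    then obtain u where "u \<in> V" "f u = y"
      by blast
    then have "(v, u) \<in> ?A\<^sup>+" "(u, w) \<in> ?A"
      using step.IH step.hyps(2) step.prems by simp_all
    then show ?case
      by (rule trancl_into_trancl)
  qed
  \<comment> \<open>The detour through some \<open>z\<close> other than \<open>x\<close> makes the
    walk nonempty even for \<open>x = y\<close>.\<close>
  have "(x, y) \<in> B\<^sup>+" if xy: "x \<in> W" "y \<in> W" for x y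
  proof -
    obtain z where z: "z \<in> W" "z \<noteq> x"
      using pq by metis
    then have "(x, z) \<in> B\<^sup>+"
      using W xy(1) by (metis strong_def rtranclD)
    moreover have "(z, y) \<in> B\<^sup>*"
      using W xy z by (simp add: strong_def)
    ultimately show ?thesis
      by (rule trancl_rtrancl_trancl)
  qed
  then have "(v, w) \<in> ?A\<^sup>+" if "v \<in> V" "w \<in> V" for v w
    using step that img by blast
  moreover have "V \<noteq> {}"
    using W img by (auto simp: strong_def)
  ultimately show ?thesis
    by (simp add: strong_def trancl_into_rtrancl)
qed

text \<open>Preimages of disjoint arc sets are disjoint. The map will be the classification of part
  vertices into two classes, the labelling of a composition over the triangle, or the inverse of an
  isomorphism.\<close>

lemma splits_pullback:
  assumes spl: "splits W F" and img: "f ` V = W" and pq: "p \<in> W" "q \<in> W" "p \<noteq> q"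
    and arc: "\<And>v w. \<lbrakk>v \<in> V; w \<in> V; (f v, f w) \<in> F\<rbrakk> \<Longrightarrow> (v, w) \<in> E"
  shows "splits V E"
proof -
  obtain A B where AB: "A \<subseteq> F \<inter> W \<times> W" "B \<subseteq> F \<inter> W \<times> W" "A \<inter> B = {}" "strong W A" "strong W B"
    using spl unfolding splits_def by blast
  let ?P = "\<lambda>A. {(v, w) \<in> V \<times> V. (f v, f w) \<in> A}"
  have "strong V (?P A)" "strong V (?P B)"
    using AB by (intro strong_pullback[OF _ img pq]; blast)+
  moreover have "?P A \<subseteq> E \<inter> V \<times> V" "?P B \<subseteq> E \<inter> V \<times> V" "?P A \<inter> ?P B = {}"
    using AB arc by auto
  ultimately show ?thesis
    unfolding splits_def by (intro exI[of _ "?P A"] exI[of _ "?P B"] conjI)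
qed

text \<open>Any two vertices of \<open>W\<close> are joined through the strong core
  \<open>V\<close>: enter it, cross it inside \<open>A\<close>, leave it.\<close>

lemma strong_extend:
  assumes "strong V A" "A \<subseteq> A'" "V \<subseteq> W"
    and into: "\<And>w. w \<in> W \<Longrightarrow> \<exists>v \<in> V. (v, w) \<in> A'\<^sup>*"
    and out: "\<And>w. w \<in> W \<Longrightarrow> \<exists>v \<in> V. (w, v) \<in> A'\<^sup>*"
  shows "strong W A'"
  unfolding strong_def
proof (intro conjI ballI)
  show "W \<noteq> {}"
    using assms by (auto simp: strong_def)
  fix x y assume "x \<in> W" "y \<in> W"
  then obtain v w where "v \<in> V" "(x, v) \<in> A'\<^sup>*" "w \<in> V" "(w, y) \<in> A'\<^sup>*"
    using into out by metis
  moreover from this have "(v, w) \<in> A'\<^sup>*"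
    using assms by (meson strong_def rtrancl_mono subsetD)
  ultimately show "(x, y) \<in> A'\<^sup>*"
    by (meson rtrancl_trans)
qed

section \<open>Closed spanning walks as certificates\<close>

abbreviation closed_walk_arcs :: "'a list \<Rightarrow> 'a rel" where
  "closed_walk_arcs ws \<equiv> set (zip ws (rotate1 ws))"

lemma strong_closed_walk:
  assumes "ws \<noteq> []"
  shows "strong (set ws) (closed_walk_arcs ws)"
proof -
  let ?n = "length ws" and ?A = "closed_walk_arcs ws"
  have arc: "(ws ! i, ws ! (Suc i mod ?n)) \<in> ?A" if "i < ?n" for i
    using that by (auto simp: set_zip nth_rotate1)
  have walk: "(ws ! (i mod ?n), ws ! ((i + k) mod ?n)) \<in> ?A\<^sup>*" for i k
  proof (induction k)
    case (Suc k)
    have "(ws ! ((i + k) mod ?n), ws ! ((i + Suc k) mod ?n)) \<in> ?A"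
      using arc[of "(i + k) mod ?n"] assms by (simp add: mod_Suc_eq)
    then show ?case
      using Suc by (rule rtrancl_into_rtrancl[rotated])
  qed simp
  \<comment> \<open>From position \<open>i\<close>, \<open>?n - i\<close> steps complete the turn to
    position 0 and \<open>j\<close> more reach position \<open>j\<close>; since
    \<open>i < ?n\<close>, the subtraction is exact.\<close>
  have "(ws ! i, ws ! j) \<in> ?A\<^sup>*" if "i < ?n" "j < ?n" for i j
    using walk[of i "?n - i + j"] that by simp
  then show ?thesis
    using assms by (auto simp: strong_def in_set_conv_nth)
qed

text \<open>A decomposition is reduced to comparing the arc sets of two lists. The lists may repeat
  vertices and arcs, so they need not be Hamiltonian cycles.\<close>

lemma splits_closed_walks:
  assumes "set ws = V" "set ws' = V" "V \<noteq> {}"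
    and "closed_walk_arcs ws \<inter> closed_walk_arcs ws' = {}"
    and "closed_walk_arcs ws \<subseteq> E" "closed_walk_arcs ws' \<subseteq> E"
  shows "splits V E"
proof -
  have "closed_walk_arcs xs \<subseteq> set xs \<times> set xs" for xs :: "'a list"
    by (auto dest: set_zip_leftD set_zip_rightD)
  moreover have "ws \<noteq> []" "ws' \<noteq> []"
    using assms by auto
  then have "strong V (closed_walk_arcs ws)" "strong V (closed_walk_arcs ws')"
    using strong_closed_walk[of ws] strong_closed_walk[of ws'] assms(1,2) by simp_all
  ultimately show ?thesis
    unfolding splits_def using assms
    by (intro exI[of _ "closed_walk_arcs ws"] exI[of _ "closed_walk_arcs ws'"]) auto
qed

section \<open>Decompositions of compositions\<close>

locale blow_up =
  fixes T :: "'a pair_pre_digraph" and H :: "'a \<Rightarrow> 'b pair_pre_digraph"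
  assumes T: "pair_digraph T"
    and strong_T: "strong (pverts T) (parcs T)"
    and H: "\<And>u. u \<in> pverts T \<Longrightarrow> pair_digraph (H u)"
    and card_H: "\<And>u. u \<in> pverts T \<Longrightarrow> card (pverts (H u)) \<ge> 2"
begin

abbreviation E :: "('a \<times> 'b) rel" where
  "E \<equiv> parcs (composition T H)"

abbreviation blow :: "'a set \<Rightarrow> ('a \<times> 'b) set" where
  "blow S \<equiv> (SIGMA u : S. pverts (H u))"

lemma arcs_T: "parcs T \<subseteq> pverts T \<times> pverts T"
proof -
  interpret pair_digraph T by (rule T)
  show ?thesis using in_arcsD1 in_arcsD2 by auto
qed

lemma no_loop: "(u, u) \<notin> parcs T"
  using pair_loopfree_digraph.pair_no_loops[of T "(u, u)"] T by (auto simp: pair_digraph_def)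

lemma arcs_E: "E \<subseteq> blow (pverts T) \<times> blow (pverts T)"
proof -
  have "x \<in> pverts (H u) \<and> y \<in> pverts (H u)" if "u \<in> pverts T" "(x, y) \<in> parcs (H u)" for u x y
  proof -
    interpret pair_digraph "H u" using H that by blast
    show ?thesis using that in_arcsD1 in_arcsD2 by auto
  qed
  then show ?thesis
    using arcs_T by (auto simp: composition_def)
qed

lemma pverts_composition: "pverts (composition T H) = blow (pverts T)"
  by (simp add: composition_def)

lemma good_iff: "good_decomposition (composition T H) \<longleftrightarrow> splits (blow (pverts T)) E"
  using good_decomposition_iff_splits arcs_E by (metis pverts_composition)

lemma cross_arc:
  "(u, v) \<in> parcs T \<Longrightarrow> x \<in> pverts (H u) \<Longrightarrow> y \<in> pverts (H v) \<Longrightarrow> ((u, x), (v, y)) \<in> E"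
  by (auto simp: composition_def)

text \<open>The distinguished vertex divides each part into the class \<open>{rep u}\<close> and the
  remaining vertices; \<open>ex_class\<close> shows that both classes are inhabited.\<close>

definition rep :: "'a \<Rightarrow> 'b" where
  "rep u = (SOME x. x \<in> pverts (H u))"

lemma ex_class:
  assumes "u \<in> pverts T"
  shows "\<exists>x \<in> pverts (H u). (x = rep u) = b"
proof -
  have c: "card (pverts (H u)) \<ge> 2"
    using card_H assms by blast
  then have ne: "pverts (H u) \<noteq> {}"
    by auto
  then have r: "rep u \<in> pverts (H u)"
    unfolding rep_def by (simp add: some_in_eq)
  moreover have "\<exists>y \<in> pverts (H u). y \<noteq> rep u"
  proof (rule ccontr)
    assume "\<not> ?thesis"
    then have "pverts (H u) = {rep u}"
      using r by blast
    then show False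
      using c by simp
  qed
  ultimately show ?thesis
    by (cases b) auto
qed

text \<open>
  Every arc of T outside S yields arcs for both strong parts: one part takes the arcs joining
  equal classes, the other the arcs joining different classes, so that walks of T lift to
  either part, from any end.
\<close>
lemma splits_extend:
  assumes spl: "splits (blow S) E" and S: "S \<subseteq> pverts T" "S \<noteq> {}"
  shows "splits (blow (pverts T)) E"
proof -
  \<comment> \<open>Without the arcs inside \<open>S\<close>, the added arcs cannot collide with the
    given decomposition of \<open>blow S\<close>.\<close>
  let ?P = "parcs T - S \<times> S"
  define N where "N b = {((u, x), (v, y)) | u x v y. (u, v) \<in> ?P \<and> x \<in> pverts (H u) \<and>
    y \<in> pverts (H v) \<and> ((x = rep u) = (y = rep v)) = b}" for b
  \<comment> \<open>Restarting a walk from \<open>S\<close> at each return to \<open>S\<close>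
    leaves only arcs that end outside \<open>S\<close>, and these lie in \<open>?P\<close>. The dual
    statement \<open>to_S\<close> restarts from the other end.\<close>
  have from_S: "\<exists>s \<in> S. (s, v) \<in> ?P\<^sup>*" if "v \<in> pverts T" for v
  proof -
    obtain s0 where s0: "s0 \<in> S"
      using S by blast
    then have "(s0, v) \<in> (parcs T)\<^sup>*"
      using strong_T that S by (auto simp: strong_def)
    then show ?thesis
    proof induction
      case base
      then show ?case using s0 by blast
    next
      case (step y z)
      show ?case
      proof (cases "z \<in> S")
        case False
        then show ?thesis using step by (metis DiffI SigmaD2 rtrancl.rtrancl_into_rtrancl)
      qed blast
    qed
  qed
  have to_S: "\<exists>s \<in> S. (v, s) \<in> ?P\<^sup>*" if "v \<in> pverts T" for v
  proof -
    obtain s0 where s0: "s0 \<in> S"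
      using S by blast
    then have "(v, s0) \<in> (parcs T)\<^sup>*"
      using strong_T that S by (auto simp: strong_def)
    then show ?thesis
    proof (induction rule: converse_rtrancl_induct)
      case base
      then show ?case using s0 by blast
    next
      case (step y z)
      show ?case
      proof (cases "y \<in> S")
        case False
        then show ?thesis using step by (metis DiffI SigmaD1 converse_rtrancl_into_rtrancl)
      qed blast
    qed
  qed
  have lift_back: "\<exists>x \<in> pverts (H s). ((s, x), (v, y)) \<in> (N b)\<^sup>*"
    if "(s, v) \<in> ?P\<^sup>*" "y \<in> pverts (H v)" for s v y b
    using that
  proof (induction arbitrary: y)
    case (step u w)
    then have "u \<in> pverts T"
      using arcs_T by blast
    \<comment> \<open>The class at the head of an arc and the value \<open>b\<close> determine the
      class needed at its tail, and \<open>ex_class\<close> supplies a vertex in that class.\<close>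
    then obtain x where x: "x \<in> pverts (H u)" "(x = rep u) = ((y = rep w) = b)"
      using ex_class by blast
    then have "((u, x), (w, y)) \<in> N b"
      using step unfolding N_def by blast
    then show ?case
      using step.IH[OF x(1)] by (meson rtrancl_into_rtrancl)
  qed auto
  have lift: "\<exists>y \<in> pverts (H s). ((v, x), (s, y)) \<in> (N b)\<^sup>*"
    if "(v, s) \<in> ?P\<^sup>*" "x \<in> pverts (H v)" for s v x b
    using that
  proof (induction arbitrary: x rule: converse_rtrancl_induct)
    case (step u w)
    then have "w \<in> pverts T"
      using arcs_T by blast
    then obtain y where y: "y \<in> pverts (H w)" "(y = rep w) = ((x = rep u) = b)"
      using ex_class by blast
    then have "((u, x), (w, y)) \<in> N b"
      using step unfolding N_def by blast
    then show ?case
      using step.IH[OF y(1)] by (meson converse_rtrancl_into_rtrancl)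
  qed auto
  have str: "strong (blow (pverts T)) (A \<union> N b)" if "strong (blow S) A" for A b
    using that
  proof (rule strong_extend)
    show "blow S \<subseteq> blow (pverts T)"
      using S by blast
    fix w assume "w \<in> blow (pverts T)"
    then obtain v y where v: "v \<in> pverts T" "y \<in> pverts (H v)" "w = (v, y)"
      by blast
    have *: "(N b)\<^sup>* \<subseteq> (A \<union> N b)\<^sup>*"
      by (simp add: rtrancl_mono)
    from from_S v(1) obtain s where s: "s \<in> S" "(s, v) \<in> ?P\<^sup>*"
      by blast
    show "\<exists>u \<in> blow S. (u, w) \<in> (A \<union> N b)\<^sup>*"
      using lift_back[OF s(2) v(2), of b] s(1) v(3) * by blast
    from to_S v(1) obtain s where s: "s \<in> S" "(v, s) \<in> ?P\<^sup>*"
      by blast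
    show "\<exists>u \<in> blow S. (w, u) \<in> (A \<union> N b)\<^sup>*"
      using lift[OF s(2) v(2), of b] s(1) v(3) * by blast
  qed simp
  obtain A B where AB: "A \<subseteq> E \<inter> blow S \<times> blow S" "B \<subseteq> E \<inter> blow S \<times> blow S" "A \<inter> B = {}"
      "strong (blow S) A" "strong (blow S) B"
    using spl unfolding splits_def by blast
  have N: "N b \<subseteq> E" for b
    unfolding N_def using cross_arc by blast
  have out: "N b \<inter> blow S \<times> blow S = {}" for b
    unfolding N_def by auto
  have "N True \<inter> N False = {}"
    unfolding N_def by auto
  then have "(A \<union> N True) \<inter> (B \<union> N False) = {}"
    using AB(1-3) out by blast
  moreover have "A \<union> N True \<subseteq> E" "B \<union> N False \<subseteq> E"
    using AB(1,2) N by simp_all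
  then have "A \<union> N True \<subseteq> E \<inter> blow (pverts T) \<times> blow (pverts T)"
      "B \<union> N False \<subseteq> E \<inter> blow (pverts T) \<times> blow (pverts T)"
    using arcs_E by (simp_all only: Int_absorb2)
  ultimately show ?thesis
    unfolding splits_def using str AB(4,5)
    by (intro exI[of _ "A \<union> N True"] exI[of _ "B \<union> N False"] conjI)
qed

text \<open>The second component of a walk entry tells whether the vertex is the distinguished one
  of its part. The walks decompose the doubled vertex set \<open>S \<times> UNIV\<close>; pulling
  back along the classification gives \<open>blow S\<close> for parts of any size, and
  \<open>splits_extend\<close> adds the parts outside \<open>S\<close>. Only arcs between parts are
  used, so \<open>cross_arc\<close> covers every preimage.\<close>

lemma splits_even_cycle:
  fixes ws ws' :: "('a \<times> bool) list"
  assumes S: "S \<subseteq> pverts T" "S \<noteq> {}"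
    and "set ws = S \<times> UNIV" "set ws' = S \<times> UNIV"
    and "closed_walk_arcs ws \<inter> closed_walk_arcs ws' = {}"
    and arcs: "\<And>u b v c. ((u, b), (v, c)) \<in> closed_walk_arcs ws \<union> closed_walk_arcs ws' \<Longrightarrow> (u, v) \<in> parcs T"
  shows "splits (blow (pverts T)) E"
proof -
  let ?F = "closed_walk_arcs ws \<union> closed_walk_arcs ws'"
  let ?f = "\<lambda>(u, x). (u, x = rep u)"
  have spl: "splits (S \<times> UNIV) ?F"
    using assms by (intro splits_closed_walks[of ws _ ws']) auto
  have img: "?f ` blow S = S \<times> UNIV"
  proof (intro equalityI subsetI)
    fix z :: "'a \<times> bool" assume "z \<in> S \<times> UNIV"
    then obtain u b where u: "u \<in> S" "z = (u, b)"
      by blast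
    then obtain x where "x \<in> pverts (H u)" "(x = rep u) = b"
      using ex_class S by blast
    then show "z \<in> ?f ` blow S"
      using u by (intro image_eqI[of _ _ "(u, x)"]) auto
  qed auto
  obtain s where s: "s \<in> S"
    using S by blast
  have "splits (blow S) E"
  proof (rule splits_pullback[OF spl img])
    show "(s, True) \<in> S \<times> UNIV" "(s, False) \<in> S \<times> UNIV" "(s, True) \<noteq> (s, False)"
      using s by auto
    show "(v, w) \<in> E" if "v \<in> blow S" "w \<in> blow S" "(?f v, ?f w) \<in> ?F" for v w
      using that arcs by (cases v; cases w) (auto intro!: cross_arc)
  qed
  then show ?thesis
    using S by (rule splits_extend)
qed

text \<open>The first walk changes class only from \<open>b\<close> to \<open>a\<close>, the second
  only from \<open>a\<close> to \<open>b\<close>. With one change per turn, each closes after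
  exactly two turns, having met both classes of both parts.\<close>

lemma splits_2_cycle:
  assumes "(a, b) \<in> parcs T" "(b, a) \<in> parcs T"
  shows "splits (blow (pverts T)) E"
proof -
  have "a \<noteq> b" "{a, b} \<subseteq> pverts T"
    using assms no_loop arcs_T by blast+
  then show ?thesis
    using assms
    by (intro splits_even_cycle[of "{a, b}"
        "[(a, True), (b, True), (a, False), (b, False)]"
        "[(a, True), (b, False), (a, False), (b, True)]"])
      (auto simp: UNIV_bool)
qed

text \<open>The first walk changes class only from \<open>d\<close> to \<open>a\<close>, the second
  on the three other arcs of the cycle. Both numbers of changes per turn are odd, so each walk
  closes after two turns.\<close>

lemma splits_4_cycle:
  assumes arcs: "(a, b) \<in> parcs T" "(b, c) \<in> parcs T" "(c, d) \<in> parcs T" "(d, a) \<in> parcs T"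
    and "distinct [a, b, c, d]"
  shows "splits (blow (pverts T)) E"
proof (rule splits_even_cycle)
  let ?w = "[(a, True), (b, True), (c, True), (d, True), (a, False), (b, False), (c, False), (d, False)]"
  let ?w' = "[(a, True), (b, False), (c, True), (d, False), (a, False), (b, True), (c, False), (d, True)]"
  show "{a, b, c, d} \<subseteq> pverts T" "{a, b, c, d} \<noteq> {}"
    using arcs arcs_T by blast+
  show "set ?w = {a, b, c, d} \<times> UNIV" "set ?w' = {a, b, c, d} \<times> UNIV"
    by (auto simp: UNIV_bool)
  show "closed_walk_arcs ?w \<inter> closed_walk_arcs ?w' = {}"
    using assms(5) by simp
  show "(u, v) \<in> parcs T" if "((u, i), (v, j)) \<in> closed_walk_arcs ?w \<union> closed_walk_arcs ?w'" for u i v j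
    using that arcs by auto
qed

end

section \<open>Compositions over the directed triangle\<close>

text \<open>A common form for the three exceptions and for the seven models decomposed below. The
  parts lie over 0, 1, 2 in the direction of the triangle.\<close>

definition C3_subst ::
  "nat \<Rightarrow> nat rel \<Rightarrow> nat \<Rightarrow> nat rel \<Rightarrow> nat \<Rightarrow> nat rel \<Rightarrow> (nat \<times> nat) pair_pre_digraph" where
  "C3_subst k R l S m U = composition (dicycle 3)
     ((!) [\<lparr>pverts = {..<k}, parcs = R\<rparr>, \<lparr>pverts = {..<l}, parcs = S\<rparr>, \<lparr>pverts = {..<m}, parcs = U\<rparr>])"

lemma dicycle_3: "pverts (dicycle 3) = {0, 1, 2}" "parcs (dicycle 3) = {(0, 1), (1, 2), (2, 0)}"
proof -
  have *: "i < 3 \<longleftrightarrow> i = 0 \<or> i = 1 \<or> i = (2::nat)" for i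
    by auto
  show "pverts (dicycle 3) = {0, 1, 2}"
    by (auto simp: dicycle_def *)
  show "parcs (dicycle 3) = {(0, 1), (1, 2), (2, 0)}"
    unfolding dicycle_def * by (auto intro: exI[of _ 0] exI[of _ 1] exI[of _ 2])
qed

lemma pverts_C3_subst:
  "pverts (C3_subst k R l S m U) = {0} \<times> {..<k} \<union> {1} \<times> {..<l} \<union> {2} \<times> {..<m}"
  by (auto simp: C3_subst_def composition_def dicycle_3)

lemma parcs_C3_subst:
  "parcs (C3_subst k R l S m U) =
     (\<lambda>(x, y). ((0, x), (0, y))) ` R \<union> (\<lambda>(x, y). ((1, x), (1, y))) ` S \<union>
     (\<lambda>(x, y). ((2, x), (2, y))) ` U \<union>
     ({0} \<times> {..<k}) \<times> ({1} \<times> {..<l}) \<union> ({1} \<times> {..<l}) \<times> ({2} \<times> {..<m}) \<union>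
     ({2} \<times> {..<m}) \<times> ({0} \<times> {..<k})"
  by (auto simp: C3_subst_def composition_def dicycle_3 image_iff)

section \<open>Seven explicit decompositions\<close>

lemma splits_C3_subst_2cycle:
  "splits (pverts (C3_subst 2 {(0, 1), (1, 0)} 2 {} 2 {})) (parcs (C3_subst 2 {(0, 1), (1, 0)} 2 {} 2 {}))"
  \<comment> \<open>The first walk is a Hamiltonian cycle without inner arcs. The second links two
    disjoint triangles by the two opposite arcs inside part 0.\<close>
  by (rule splits_closed_walks[of
      "[(0, 0), (1, 1), (2, 0), (0, 1), (1, 0), (2, 1)]" _
      "[(0, 0), (1, 0), (2, 0), (0, 0), (0, 1), (1, 1), (2, 1), (0, 1)]"])
    (auto simp: pverts_C3_subst parcs_C3_subst lessThan_nat_numeral)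

lemma splits_C3_subst_two_arcs:
  "splits (pverts (C3_subst 2 {(0, 1)} 2 {(0, 1)} 2 {})) (parcs (C3_subst 2 {(0, 1)} 2 {(0, 1)} 2 {}))"
  \<comment> \<open>The first walk is a Hamiltonian cycle without inner arcs; the second uses both
    inner arcs and repeats the arc from \<open>(0, 1)\<close> to \<open>(1, 0)\<close>.\<close>
  by (rule splits_closed_walks[of
      "[(0, 0), (1, 0), (2, 0), (0, 1), (1, 1), (2, 1)]" _
      "[(0, 0), (0, 1), (1, 0), (2, 1), (0, 1), (1, 0), (1, 1), (2, 0)]"])
    (auto simp: pverts_C3_subst parcs_C3_subst lessThan_nat_numeral)

lemma splits_C3_subst_3_arc0:
  "splits (pverts (C3_subst 3 {(0, 1)} 2 {} 2 {})) (parcs (C3_subst 3 {(0, 1)} 2 {} 2 {}))"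
  \<comment> \<open>Here the second walk is a Hamiltonian cycle through the inner arc.\<close>
  by (rule splits_closed_walks[of
      "[(0, 0), (1, 1), (2, 0), (0, 2), (1, 1), (2, 0), (0, 1), (1, 0), (2, 1)]" _
      "[(0, 0), (0, 1), (1, 1), (2, 1), (0, 2), (1, 0), (2, 0)]"])
    (auto simp: pverts_C3_subst parcs_C3_subst lessThan_nat_numeral)

lemma splits_C3_subst_3_arc1:
  "splits (pverts (C3_subst 3 {} 2 {(0, 1)} 2 {})) (parcs (C3_subst 3 {} 2 {(0, 1)} 2 {}))"
  by (rule splits_closed_walks[of
      "[(0, 0), (1, 1), (2, 0), (0, 1), (1, 1), (2, 0), (0, 2), (1, 0), (2, 1)]" _
      "[(0, 0), (1, 0), (1, 1), (2, 1), (0, 2), (1, 1), (2, 1), (0, 1), (1, 0), (2, 0)]"])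
    (auto simp: pverts_C3_subst parcs_C3_subst lessThan_nat_numeral)

lemma splits_C3_subst_3_arc2:
  "splits (pverts (C3_subst 3 {} 2 {} 2 {(0, 1)})) (parcs (C3_subst 3 {} 2 {} 2 {(0, 1)}))"
  by (rule splits_closed_walks[of
      "[(0, 0), (1, 1), (2, 0), (0, 1), (1, 1), (2, 0), (0, 2), (1, 0), (2, 1)]" _
      "[(0, 0), (1, 0), (2, 0), (2, 1), (0, 2), (1, 1), (2, 1), (0, 1), (1, 0), (2, 0)]"])
    (auto simp: pverts_C3_subst parcs_C3_subst lessThan_nat_numeral)

lemma splits_C3_subst_4:
  "splits (pverts (C3_subst 4 {} 2 {} 2 {})) (parcs (C3_subst 4 {} 2 {} 2 {}))"
  \<comment> \<open>Each walk makes four turns, meeting every vertex of part 0 once and every other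
    vertex twice.\<close>
  by (rule splits_closed_walks[of
      "[(0, 0), (1, 0), (2, 0), (0, 1), (1, 0), (2, 0), (0, 3), (1, 1), (2, 1), (0, 2), (1, 1), (2, 1)]" _
      "[(0, 0), (1, 1), (2, 0), (0, 2), (1, 0), (2, 1), (0, 3), (1, 0), (2, 1), (0, 1), (1, 1), (2, 0)]"])
    (auto simp: pverts_C3_subst parcs_C3_subst lessThan_nat_numeral)

lemma splits_C3_subst_3_3:
  "splits (pverts (C3_subst 3 {} 3 {} 2 {})) (parcs (C3_subst 3 {} 3 {} 2 {}))"
  \<comment> \<open>Each walk makes three turns and repeats one vertex of part 2, a different one in
    the two walks.\<close>
  by (rule splits_closed_walks[of
      "[(0, 0), (1, 1), (2, 1), (0, 1), (1, 2), (2, 1), (0, 2), (1, 0), (2, 0)]" _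
      "[(0, 0), (1, 2), (2, 0), (0, 2), (1, 1), (2, 0), (0, 1), (1, 0), (2, 1)]"])
    (auto simp: pverts_C3_subst parcs_C3_subst lessThan_nat_numeral)

section \<open>Cut conditions and the exceptions\<close>

lemma splits_cut:
  assumes "splits V E"
  shows "\<exists>P :: 'a \<times> 'a \<Rightarrow> bool. \<forall>S s v b. S \<subseteq> V \<longrightarrow> s \<in> S \<longrightarrow> v \<in> V \<longrightarrow> v \<notin> S \<longrightarrow>
    (\<exists>e \<in> E. (P e \<longleftrightarrow> b) \<and> fst e \<in> S \<and> snd e \<notin> S)"
proof -
  obtain A B where AB: "A \<subseteq> E \<inter> V \<times> V" "B \<subseteq> E \<inter> V \<times> V" "A \<inter> B = {}" "strong V A" "strong V B"
    using assms unfolding splits_def by (elim exE conjE)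
  show ?thesis
  \<comment> \<open>Membership in \<open>A\<close> gives one propositional variable per arc. Arcs of
    \<open>B\<close> make it false by disjointness, so each cut yields one clause for each value of
    \<open>b\<close>.\<close>
  proof (intro exI[of _ "\<lambda>e. e \<in> A"] allI impI)
    fix S s v b assume S: "S \<subseteq> V" "s \<in> S" "v \<in> V" "v \<notin> S"
    then have ne: "S \<noteq> {}" "S \<noteq> V"
      by auto
    obtain e where e: "e \<in> A" "fst e \<in> S" "snd e \<notin> S"
      using strong_cut[OF AB(4) _ S(1) ne] AB(1) by auto
    obtain e' where e': "e' \<in> B" "fst e' \<in> S" "snd e' \<notin> S"
      using strong_cut[OF AB(5) _ S(1) ne] AB(2) by auto
    show "\<exists>e \<in> E. (e \<in> A \<longleftrightarrow> b) \<and> fst e \<in> S \<and> snd e \<notin> S"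
    proof (cases b)
      case True
      then show ?thesis
        using e AB(1) by (intro bexI[of _ e]) auto
    next
      case False
      then show ?thesis
        using e' AB(2,3) by (intro bexI[of _ e']) auto
    qed
  qed
qed

text \<open>
  In a decomposition both arc sets meet every cut. The cuts below, found by computer search,
  already make these requirements propositionally inconsistent.
\<close>
lemma not_splits_C3_subst_arc:
  "\<not> splits (pverts (C3_subst 2 {(0, 1)} 2 {} 2 {})) (parcs (C3_subst 2 {(0, 1)} 2 {} 2 {}))"
    (is "\<not> splits ?V ?E")
proof
  let ?A = "{((0, 0), (1, 0)), ((0, 0), (1, 1)), ((0, 1), (1, 0)), ((0, 1), (1, 1)), ((1, 0), (2, 0)), ((1, 0), (2, 1)), ((1, 1), (2, 0)), ((1, 1), (2, 1)), ((2, 0), (0, 0)), ((2, 0), (0, 1)), ((2, 1), (0, 0)), ((2, 1), (0, 1)), ((0, 0), (0, 1))}"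
  have V: "?V = {(0, 0), (0, 1), (1, 0), (1, 1), (2, 0), (2, 1)}"
    by (auto simp: pverts_C3_subst lessThan_nat_numeral)
  have "?E \<subseteq> ?A"
    by (auto simp: parcs_C3_subst lessThan_nat_numeral)
  moreover assume "splits ?V ?E"
  ultimately have "splits ?V ?A"
    by (rule splits_mono[rotated])
  from splits_cut[OF this] obtain P where "\<forall>S s v b. S \<subseteq> ?V \<longrightarrow> s \<in> S \<longrightarrow> v \<in> ?V \<longrightarrow> v \<notin> S \<longrightarrow>
      (\<exists>e \<in> ?A. (P e \<longleftrightarrow> b) \<and> fst e \<in> S \<and> snd e \<notin> S)" ..
  note cut = this[rule_format, unfolded V]
  \<comment> \<open>The cuts \<open>c0\<close> to \<open>c3\<close> are degree conditions at single
    vertices; \<open>c4\<close> to \<open>c7\<close> take one vertex from each part. Every set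
    containing \<open>(0, 0)\<close> also contains \<open>(0, 1)\<close>, so the inner arc leaves
    none of them and occurs in no clause.\<close>
  have c0: "(P ((1, 0), (2, 0)) = b) \<or> (P ((1, 0), (2, 1)) = b)" for b
    using cut[of "{(1, 0)}" "(1, 0)" "(0, 0)" b] by simp
  have c1: "(P ((1, 1), (2, 0)) = b) \<or> (P ((1, 1), (2, 1)) = b)" for b
    using cut[of "{(1, 1)}" "(1, 1)" "(0, 0)" b] by simp
  have c2: "(P ((1, 0), (2, 1)) = b) \<or> (P ((1, 1), (2, 1)) = b)" for b
    using cut[of "{(0, 0), (0, 1), (1, 0), (1, 1), (2, 0)}" "(0, 0)" "(2, 1)" b] by simp
  have c3: "(P ((2, 0), (0, 0)) = b) \<or> (P ((2, 1), (0, 0)) = b)" for b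
    using cut[of "{(0, 1), (1, 0), (1, 1), (2, 0), (2, 1)}" "(0, 1)" "(0, 0)" b] by simp
  have c4: "(P ((0, 1), (1, 0)) = b) \<or> (P ((1, 1), (2, 0)) = b) \<or> (P ((2, 1), (0, 0)) = b)" for b
    using cut[of "{(0, 1), (1, 1), (2, 1)}" "(0, 1)" "(0, 0)" b] by simp
  have c5: "(P ((0, 1), (1, 0)) = b) \<or> (P ((1, 1), (2, 1)) = b) \<or> (P ((2, 0), (0, 0)) = b)" for b
    using cut[of "{(0, 1), (1, 1), (2, 0)}" "(0, 1)" "(0, 0)" b] by simp
  have c6: "(P ((0, 1), (1, 1)) = b) \<or> (P ((1, 0), (2, 1)) = b) \<or> (P ((2, 0), (0, 0)) = b)" for b
    using cut[of "{(0, 1), (1, 0), (2, 0)}" "(0, 1)" "(0, 0)" b] by simp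
  have c7: "(P ((0, 1), (1, 1)) = b) \<or> (P ((1, 0), (2, 0)) = b) \<or> (P ((2, 1), (0, 0)) = b)" for b
    using cut[of "{(0, 1), (1, 0), (2, 1)}" "(0, 1)" "(0, 0)" b] by simp
  show False
    \<comment> \<open>Instantiating \<open>b\<close> and simplifying turns each equation
      \<open>P e = b\<close> into a literal.\<close>
    using c0[of True] c0[of False] c1[of True] c1[of False] c2[of True] c2[of False] c3[of True] c3[of False] c4[of True] c4[of False] c5[of True] c5[of False] c6[of True] c6[of False] c7[of True] c7[of False]
    unfolding simp_thms by sat
qed

text \<open>Again the clauses of finitely many cuts are inconsistent. The cuts \<open>c0\<close> to
  \<open>c8\<close> are degree conditions: where only two arcs leave or enter a vertex, each side
  receives exactly one. The sets in \<open>c9\<close> to \<open>c22\<close> meet all three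
  parts.\<close>

lemma not_splits_C3_subst_3:
  "\<not> splits (pverts (C3_subst 2 {} 2 {} 3 {})) (parcs (C3_subst 2 {} 2 {} 3 {}))"
    (is "\<not> splits ?V ?E")
proof
  let ?A = "{((0, 0), (1, 0)), ((0, 0), (1, 1)), ((0, 1), (1, 0)), ((0, 1), (1, 1)), ((1, 0), (2, 0)), ((1, 0), (2, 1)), ((1, 0), (2, 2)), ((1, 1), (2, 0)), ((1, 1), (2, 1)), ((1, 1), (2, 2)), ((2, 0), (0, 0)), ((2, 0), (0, 1)), ((2, 1), (0, 0)), ((2, 1), (0, 1)), ((2, 2), (0, 0)), ((2, 2), (0, 1))}"
  have V: "?V = {(0, 0), (0, 1), (1, 0), (1, 1), (2, 0), (2, 1), (2, 2)}"
    by (auto simp: pverts_C3_subst lessThan_nat_numeral)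
  have "?E \<subseteq> ?A"
    by (auto simp: parcs_C3_subst lessThan_nat_numeral)
  moreover assume "splits ?V ?E"
  ultimately have "splits ?V ?A"
    by (rule splits_mono[rotated])
  from splits_cut[OF this] obtain P where "\<forall>S s v b. S \<subseteq> ?V \<longrightarrow> s \<in> S \<longrightarrow> v \<in> ?V \<longrightarrow> v \<notin> S \<longrightarrow>
      (\<exists>e \<in> ?A. (P e \<longleftrightarrow> b) \<and> fst e \<in> S \<and> snd e \<notin> S)" ..
  note cut = this[rule_format, unfolded V]
  have c0: "(P ((0, 0), (1, 0)) = b) \<or> (P ((0, 0), (1, 1)) = b)" for b
    using cut[of "{(0, 0)}" "(0, 0)" "(0, 1)" b] by simp
  have c1: "(P ((0, 1), (1, 0)) = b) \<or> (P ((0, 1), (1, 1)) = b)" for b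
    using cut[of "{(0, 1)}" "(0, 1)" "(0, 0)" b] by simp
  have c2: "(P ((2, 0), (0, 0)) = b) \<or> (P ((2, 0), (0, 1)) = b)" for b
    using cut[of "{(2, 0)}" "(2, 0)" "(0, 0)" b] by simp
  have c3: "(P ((2, 1), (0, 0)) = b) \<or> (P ((2, 1), (0, 1)) = b)" for b
    using cut[of "{(2, 1)}" "(2, 1)" "(0, 0)" b] by simp
  have c4: "(P ((2, 2), (0, 0)) = b) \<or> (P ((2, 2), (0, 1)) = b)" for b
    using cut[of "{(2, 2)}" "(2, 2)" "(0, 0)" b] by simp
  have c5: "(P ((1, 0), (2, 2)) = b) \<or> (P ((1, 1), (2, 2)) = b)" for b
    using cut[of "{(0, 0), (0, 1), (1, 0), (1, 1), (2, 0), (2, 1)}" "(0, 0)" "(2, 2)" b] by simp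
  have c6: "(P ((1, 0), (2, 1)) = b) \<or> (P ((1, 1), (2, 1)) = b)" for b
    using cut[of "{(0, 0), (0, 1), (1, 0), (1, 1), (2, 0), (2, 2)}" "(0, 0)" "(2, 1)" b] by simp
  have c7: "(P ((1, 0), (2, 0)) = b) \<or> (P ((1, 1), (2, 0)) = b)" for b
    using cut[of "{(0, 0), (0, 1), (1, 0), (1, 1), (2, 1), (2, 2)}" "(0, 0)" "(2, 0)" b] by simp
  have c8: "(P ((0, 0), (1, 1)) = b) \<or> (P ((0, 1), (1, 1)) = b)" for b
    using cut[of "{(0, 0), (0, 1), (1, 0), (2, 0), (2, 1), (2, 2)}" "(0, 0)" "(1, 1)" b] by simp
  have c9: "(P ((0, 0), (1, 1)) = b) \<or> (P ((1, 0), (2, 1)) = b) \<or> (P ((1, 0), (2, 2)) = b) \<or> (P ((2, 0), (0, 1)) = b)" for b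
    using cut[of "{(0, 0), (1, 0), (2, 0)}" "(0, 0)" "(0, 1)" b] by simp
  have c10: "(P ((0, 0), (1, 1)) = b) \<or> (P ((1, 0), (2, 0)) = b) \<or> (P ((2, 1), (0, 1)) = b) \<or> (P ((2, 2), (0, 1)) = b)" for b
    using cut[of "{(0, 0), (1, 0), (2, 1), (2, 2)}" "(0, 0)" "(0, 1)" b] by simp
  have c11: "(P ((0, 0), (1, 0)) = b) \<or> (P ((1, 1), (2, 0)) = b) \<or> (P ((2, 1), (0, 1)) = b) \<or> (P ((2, 2), (0, 1)) = b)" for b
    using cut[of "{(0, 0), (1, 1), (2, 1), (2, 2)}" "(0, 0)" "(0, 1)" b] by simp
  have c12: "(P ((0, 1), (1, 1)) = b) \<or> (P ((1, 0), (2, 0)) = b) \<or> (P ((2, 1), (0, 0)) = b) \<or> (P ((2, 2), (0, 0)) = b)" for b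
    using cut[of "{(0, 1), (1, 0), (2, 1), (2, 2)}" "(0, 1)" "(0, 0)" b] by simp
  have c13: "(P ((0, 1), (1, 0)) = b) \<or> (P ((1, 1), (2, 0)) = b) \<or> (P ((1, 1), (2, 1)) = b) \<or> (P ((2, 2), (0, 0)) = b)" for b
    using cut[of "{(0, 1), (1, 1), (2, 2)}" "(0, 1)" "(0, 0)" b] by simp
  have c14: "(P ((0, 1), (1, 0)) = b) \<or> (P ((1, 1), (2, 0)) = b) \<or> (P ((1, 1), (2, 2)) = b) \<or> (P ((2, 1), (0, 0)) = b)" for b
    using cut[of "{(0, 1), (1, 1), (2, 1)}" "(0, 1)" "(0, 0)" b] by simp
  have c15: "(P ((0, 0), (1, 0)) = b) \<or> (P ((1, 1), (2, 1)) = b) \<or> (P ((2, 0), (0, 1)) = b) \<or> (P ((2, 2), (0, 1)) = b)" for b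
    using cut[of "{(0, 0), (1, 1), (2, 0), (2, 2)}" "(0, 0)" "(0, 1)" b] by simp
  have c16: "(P ((0, 1), (1, 1)) = b) \<or> (P ((1, 0), (2, 1)) = b) \<or> (P ((2, 0), (0, 0)) = b) \<or> (P ((2, 2), (0, 0)) = b)" for b
    using cut[of "{(0, 1), (1, 0), (2, 0), (2, 2)}" "(0, 1)" "(0, 0)" b] by simp
  have c17: "(P ((0, 1), (1, 1)) = b) \<or> (P ((1, 0), (2, 2)) = b) \<or> (P ((2, 0), (0, 0)) = b) \<or> (P ((2, 1), (0, 0)) = b)" for b
    using cut[of "{(0, 1), (1, 0), (2, 0), (2, 1)}" "(0, 1)" "(0, 0)" b] by simp
  have c18: "(P ((0, 0), (1, 0)) = b) \<or> (P ((1, 1), (2, 2)) = b) \<or> (P ((2, 0), (0, 1)) = b) \<or> (P ((2, 1), (0, 1)) = b)" for b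
    using cut[of "{(0, 0), (1, 1), (2, 0), (2, 1)}" "(0, 0)" "(0, 1)" b] by simp
  have c19: "(P ((0, 1), (1, 0)) = b) \<or> (P ((1, 1), (2, 1)) = b) \<or> (P ((2, 0), (0, 0)) = b) \<or> (P ((2, 2), (0, 0)) = b)" for b
    using cut[of "{(0, 1), (1, 1), (2, 0), (2, 2)}" "(0, 1)" "(0, 0)" b] by simp
  have c20: "(P ((0, 0), (1, 1)) = b) \<or> (P ((1, 0), (2, 0)) = b) \<or> (P ((1, 0), (2, 1)) = b) \<or> (P ((2, 2), (0, 1)) = b)" for b
    using cut[of "{(0, 0), (1, 0), (2, 2)}" "(0, 0)" "(0, 1)" b] by simp
  have c21: "(P ((0, 1), (1, 0)) = b) \<or> (P ((1, 1), (2, 2)) = b) \<or> (P ((2, 0), (0, 0)) = b) \<or> (P ((2, 1), (0, 0)) = b)" for b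
    using cut[of "{(0, 1), (1, 1), (2, 0), (2, 1)}" "(0, 1)" "(0, 0)" b] by simp
  have c22: "(P ((0, 0), (1, 1)) = b) \<or> (P ((1, 0), (2, 0)) = b) \<or> (P ((1, 0), (2, 2)) = b) \<or> (P ((2, 1), (0, 1)) = b)" for b
    using cut[of "{(0, 0), (1, 0), (2, 1)}" "(0, 0)" "(0, 1)" b] by simp
  show False
    using c0[of True] c0[of False] c1[of True] c1[of False] c2[of True] c2[of False] c3[of True] c3[of False] c4[of True] c4[of False] c5[of True] c5[of False] c6[of True] c6[of False] c7[of True] c7[of False] c8[of True] c8[of False] c9[of True] c9[of False] c10[of True] c10[of False] c11[of True] c11[of False] c12[of True] c12[of False] c13[of True] c13[of False] c14[of True] c14[of False] c15[of True] c15[of False] c16[of True] c16[of False] c17[of True] c17[of False] c18[of True] c18[of False] c19[of True] c19[of False] c20[of True] c20[of False] c21[of True] c21[of False] c22[of True] c22[of False]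
    unfolding simp_thms by sat
qed

section \<open>Isomorphisms and numberings of parts\<close>

lemma digraph_isoI:
  assumes f: "bij_betw f (pverts G) (pverts G')" and G: "parcs G \<subseteq> pverts G \<times> pverts G"
    and arcs: "parcs G' = map_prod f f ` parcs G"
  shows "digraph_iso (with_proj G) (with_proj G')"
proof -
  let ?h = "\<lparr>iso_verts = f, iso_arcs = map_prod f f, iso_head = snd, iso_tail = fst\<rparr>"
  have inj: "inj_on f (pverts G)"
    using f by (rule bij_betw_imp_inj_on)
  have "inj_on (map_prod f f) (parcs G)"
    using map_prod_inj_on[OF inj inj] G by (rule inj_on_subset)
  moreover have "wf_digraph (with_proj G)"
    using G by unfold_locales auto
  ultimately have "pre_digraph.digraph_isomorphism (with_proj G) ?h"
    using inj by (auto simp: pre_digraph.digraph_isomorphism_def)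
  moreover have "with_proj G' = app_iso ?h (with_proj G)"
    using f arcs by (simp add: app_iso_def with_proj_def bij_betw_def)
  ultimately show ?thesis
    unfolding digraph_iso_def by blast
qed

text \<open>An isomorphism carries its own arc map, but heads and tails are the projections on both
  sides. This forces the arc map to act as the vertex map on both ends, so the inverse vertex map
  reflects arcs.\<close>

lemma splits_iso:
  assumes iso: "digraph_iso (with_proj G) (with_proj G')"
    and spl: "splits (pverts G) (parcs G)" and pq: "p \<in> pverts G" "q \<in> pverts G" "p \<noteq> q"
  shows "splits (pverts G') (parcs G')"
proof -
  obtain h where h: "pre_digraph.digraph_isomorphism (with_proj G) h"
    and G': "with_proj G' = app_iso h (with_proj G)"
    using iso unfolding digraph_iso_def by blast
  let ?f = "iso_verts h"
  have inj: "inj_on ?f (pverts G)"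
    using h by (simp add: pre_digraph.digraph_isomorphism_def)
  have verts: "pverts G' = ?f ` pverts G"
    using arg_cong[OF G', of verts] by simp
  have arcs: "parcs G' = iso_arcs h ` parcs G"
    using arg_cong[OF G', of arcs] by simp
  have th: "iso_tail h = fst" "iso_head h = snd"
    using arg_cong[OF G', of tail] arg_cong[OF G', of head] by simp_all
  have img: "inv_into (pverts G) ?f ` pverts G' = pverts G"
    unfolding verts using inj by (simp add: inj_on_imp_bij_betw bij_betw_inv_into bij_betw_imp_surj_on)
  show ?thesis
  proof (rule splits_pullback[OF spl img pq])
    fix v w assume "v \<in> pverts G'" "w \<in> pverts G'"
      and arc: "(inv_into (pverts G) ?f v, inv_into (pverts G) ?f w) \<in> parcs G"
    then have "?f (inv_into (pverts G) ?f v) = v" "?f (inv_into (pverts G) ?f w) = w"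
      unfolding verts by (auto intro: f_inv_into_f)
    then have "iso_arcs h (inv_into (pverts G) ?f v, inv_into (pverts G) ?f w) = (v, w)"
      using h arc by (force simp: pre_digraph.digraph_isomorphism_def th prod_eq_iff)
    then show "(v, w) \<in> parcs G'"
      unfolding arcs using arc by (metis imageI)
  qed
qed

lemma ex_surj_lessThan:
  assumes "k \<le> card X" "0 < k"
  shows "\<exists>f. f ` X = {..<k}"
proof -
  obtain Y where Y: "Y \<subseteq> X" "card Y = k" "finite Y"
    using assms(1) by (rule obtain_subset_with_card_n)
  then obtain g where g: "bij_betw g Y {..<k}"
    using ex_bij_betw_finite_nat[of Y] by (auto simp: atLeast0LessThan)
  \<comment> \<open>Surplus elements are sent to 0, which lies in the range because
    \<open>0 < k\<close>.\<close>
  have "(\<lambda>x. if x \<in> Y then g x else 0) ` X = {..<k}" (is "?f ` X = _")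
  proof
    show "?f ` X \<subseteq> {..<k}"
      using g assms(2) by (auto simp: bij_betw_def)
    show "{..<k} \<subseteq> ?f ` X"
    proof
      fix i assume "i \<in> {..<k}"
      then have "i \<in> g ` Y"
        using g by (simp add: bij_betw_def)
      then obtain y where "y \<in> Y" "g y = i"
        by blast
      then show "i \<in> ?f ` X"
        using Y(1) by (intro image_eqI[of _ _ y]) auto
    qed
  qed
  then show ?thesis
    by blast
qed

lemma ex_bij_lessThan:
  assumes "card X = k" "0 < k"
  shows "\<exists>f. bij_betw f X {..<k}"
  using assms ex_bij_betw_finite_nat[of X] card_gt_0_iff[of X] by (auto simp: atLeast0LessThan)

lemma ex_bij_lessThan_pair:
  assumes fin: "finite X" and k: "card X = k" and pq: "p \<in> X" "q \<in> X" "p \<noteq> q"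
  shows "\<exists>f. bij_betw f X {..<k} \<and> f p = 0 \<and> f q = (1::nat)"
proof -
  have card: "card (X - {p, q}) = k - 2"
    using assms by (simp add: card_Diff_subset)
  have "card {p, q} \<le> card X"
    using fin pq by (intro card_mono) auto
  then have "2 \<le> k"
    using k pq by simp
  obtain g where g: "bij_betw g (X - {p, q}) {..<k - 2}"
    using ex_bij_betw_finite_nat[of "X - {p, q}"] fin card by (auto simp: atLeast0LessThan)
  \<comment> \<open>The shift by 2 reserves the labels 0 and 1 for \<open>p\<close> and
    \<open>q\<close>.\<close>
  let ?f = "\<lambda>x. if x = p then 0 else if x = q then 1 else g x + 2"
  have lt: "g x < k - 2" if "x \<in> X" "x \<noteq> p" "x \<noteq> q" for x
    using g that by (auto simp: bij_betw_def)
  have "inj_on ?f X"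
  proof (rule inj_onI)
    fix x y assume "x \<in> X" "y \<in> X" "?f x = ?f y"
    then show "x = y"
      using inj_onD[OF bij_betw_imp_inj_on[OF g], of x y] by (simp split: if_splits)
  qed
  moreover have "?f x < k" if "x \<in> X" for x
    using lt[OF that] \<open>2 \<le> k\<close> by auto
  then have "?f ` X \<subseteq> {..<k}"
    by blast
  ultimately have "bij_betw ?f X {..<k}"
    unfolding bij_betw_def using k by (intro conjI card_subset_eq) (auto simp only: card_image card_lessThan finite_lessThan)
  then show ?thesis
    using pq by (intro exI[of _ ?f]) simp
qed

section \<open>Reduction to the directed triangle\<close>

context blow_up
begin

definition is_C3 :: "'a \<Rightarrow> 'a \<Rightarrow> 'a \<Rightarrow> bool" where
  "is_C3 a b c \<longleftrightarrow> distinct [a, b, c] \<and> pverts T = {a, b, c} \<and> parcs T = {(a, b), (b, c), (c, a)}"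

lemma is_C3_rotate: "is_C3 a b c \<Longrightarrow> is_C3 b c a"
  by (auto simp: is_C3_def)

text \<open>Failure to split excludes 2-cycles and 4-cycles in \<open>T\<close>. Leaving the
  out-neighbourhood of a vertex \<open>a\<close> yields a triangle through \<open>a\<close>, and a
  further vertex would create a 4-cycle.\<close>

lemma is_C3_if_not_splits:
  assumes sc: "semicomplete T" and card: "card (pverts T) \<ge> 2"
    and ns: "\<not> splits (blow (pverts T)) E"
  shows "\<exists>a b c. is_C3 a b c"
proof -
  let ?V = "pverts T" and ?A = "parcs T"
  have no2: "(v, u) \<notin> ?A" if "(u, v) \<in> ?A" for u v
    using ns splits_2_cycle that by blast
  have no4: False if "(p, q) \<in> ?A" "(q, r) \<in> ?A" "(r, s) \<in> ?A" "(s, p) \<in> ?A" for p q r s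
  proof (cases "distinct [p, q, r, s]")
    case True
    then show ?thesis
      using ns splits_4_cycle that by blast
  next
    case False
    then show ?thesis
      using that no2 no_loop by auto
  qed
  have tot: "(u, v) \<in> ?A \<or> (v, u) \<in> ?A" if "u \<in> ?V" "v \<in> ?V" "u \<noteq> v" for u v
    using sc that by (auto simp: semicomplete_def)
  have exit: "\<exists>u v. u \<in> S \<and> v \<in> ?V \<and> v \<notin> S \<and> (u, v) \<in> ?A" if "S \<subseteq> ?V" "S \<noteq> {}" "S \<noteq> ?V" for S
    using strong_cut[OF strong_T arcs_T that] by auto
  obtain a where a: "a \<in> ?V"
    using card by fastforce
  have "?V \<noteq> {a}"
    using card by auto
  then obtain v where v: "(a, v) \<in> ?A"
    using exit[of "{a}"] a by auto
  let ?O = "{v. (a, v) \<in> ?A}"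
  have "?O \<subseteq> ?V" "?O \<noteq> {}" "?O \<noteq> ?V"
    using arcs_T v no_loop a by auto
  then obtain b c where bc: "(a, b) \<in> ?A" "c \<in> ?V" "(a, c) \<notin> ?A" "(b, c) \<in> ?A"
    using exit[of ?O] by auto
  moreover from this have "c \<noteq> a"
    using no2 by blast
  ultimately have ca: "(c, a) \<in> ?A"
    using tot a by blast
  have V: "a \<in> ?V" "b \<in> ?V" "c \<in> ?V"
    using a bc arcs_T by auto
  have abc: "distinct [a, b, c]"
    using bc ca no_loop by auto
  \<comment> \<open>If \<open>v\<close> is dominated by \<open>a\<close> but not by
    \<open>b\<close>, then \<open>v\<close> dominates \<open>b\<close>, and the path from
    \<open>b\<close> over \<open>c\<close> to \<open>a\<close> closes a 4-cycle. The same argument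
    leads from \<open>b\<close> to \<open>c\<close> and from \<open>c\<close> to \<open>a\<close>,
    so domination by one triangle vertex spreads to all three.\<close>
  have all: "(a, v) \<in> ?A \<and> (b, v) \<in> ?A \<and> (c, v) \<in> ?A"
    if "v \<in> ?V" "v \<notin> {a, b, c}" "(a, v) \<in> ?A \<or> (b, v) \<in> ?A \<or> (c, v) \<in> ?A" for v
  proof -
    have "(v, b) \<notin> ?A" if "(a, v) \<in> ?A"
      using no4[OF that _ bc(4) ca] by blast
    moreover have "(v, c) \<notin> ?A" if "(b, v) \<in> ?A"
      using no4[OF that _ ca bc(1)] by blast
    moreover have "(v, a) \<notin> ?A" if "(c, v) \<in> ?A"
      using no4[OF that _ bc(1) bc(4)] by blast
    ultimately show ?thesis
      using that tot V by blast
  qed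
  have "?V = {a, b, c}"
  proof (rule ccontr)
    assume ne: "?V \<noteq> {a, b, c}"
    \<comment> \<open>Leaving the set of dominated vertices gives an arc from \<open>x\<close> to
      \<open>y\<close>. Without 2-cycles \<open>y\<close> is not on the triangle, so it dominates
      \<open>a\<close>, and \<open>b\<close>, \<open>x\<close>, \<open>y\<close>, \<open>a\<close>
      form a 4-cycle.\<close>
    let ?D = "{v \<in> ?V. v \<notin> {a, b, c} \<and> (a, v) \<in> ?A}"
    obtain u v where "u \<in> {a, b, c}" "v \<in> ?V" "v \<notin> {a, b, c}" "(u, v) \<in> ?A"
      using exit[of "{a, b, c}"] V ne by blast
    then have "v \<in> ?D"
      using all[of v] by blast
    then have "?D \<subseteq> ?V" "?D \<noteq> {}" "?D \<noteq> ?V"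
      using V by blast+
    then obtain x y where x: "x \<in> ?D" and y: "y \<in> ?V" "y \<notin> ?D" and xy: "(x, y) \<in> ?A"
      using exit[of ?D] by blast
    have dom: "(a, x) \<in> ?A" "(b, x) \<in> ?A" "(c, x) \<in> ?A"
      using all[of x] x by blast+
    then have "y \<notin> {a, b, c}"
      using xy no2 by blast
    then have "(y, a) \<in> ?A"
      using y tot V(1) by blast
    then show False
      using no4[OF dom(2) xy _ bc(1)] by blast
  qed
  moreover have "?A = {(a, b), (b, c), (c, a)}"
  proof (intro equalityI subsetI)
    fix e assume e: "e \<in> ?A"
    then have "e \<in> {a, b, c} \<times> {a, b, c}"
      using arcs_T calculation by blast
    moreover have "e \<notin> {(a, a), (b, b), (c, c), (b, a), (c, b), (a, c)}"
      using e no_loop no2[OF bc(1)] no2[OF bc(4)] bc(3) by auto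
    ultimately show "e \<in> {(a, b), (b, c), (c, a)}"
      by blast
  qed (use bc ca in blast)
  ultimately show "\<exists>a b c. is_C3 a b c"
    using abc unfolding is_C3_def by blast
qed

section \<open>Comparison with the models\<close>

lemma finite_H: "u \<in> pverts T \<Longrightarrow> finite (pverts (H u))"
  using H by (simp add: pair_digraph_def pair_fin_digraph_def pair_fin_digraph_axioms_def)

lemma arcs_H: "u \<in> pverts T \<Longrightarrow> parcs (H u) \<subseteq> pverts (H u) \<times> pverts (H u)"
proof -
  assume "u \<in> pverts T"
  then interpret pair_digraph "H u" by (rule H)
  show ?thesis using in_arcsD1 in_arcsD2 by auto
qed

lemma no_loop_H:
  assumes "u \<in> pverts T"
  shows "(x, x) \<notin> parcs (H u)"
proof -
  interpret pair_digraph "H u" using assms by (rule H)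
  show ?thesis using pair_no_loops[of "(x, x)"] by auto
qed

definition labelling ::
  "'a \<Rightarrow> 'a \<Rightarrow> ('b \<Rightarrow> nat) \<Rightarrow> ('b \<Rightarrow> nat) \<Rightarrow> ('b \<Rightarrow> nat) \<Rightarrow> 'a \<times> 'b \<Rightarrow> nat \<times> nat" where
  "labelling a b f g h = (\<lambda>(u, x). if u = a then (0, f x) else if u = b then (1, g x) else (2, h x))"

lemma labelling_simps:
  assumes "is_C3 a b c"
  shows "labelling a b f g h (a, x) = (0, f x)" "labelling a b f g h (b, x) = (1, g x)"
    "labelling a b f g h (c, x) = (2, h x)"
  using assms by (auto simp: labelling_def is_C3_def)

lemma labelling_comp:
  assumes "is_C3 a b c"
  shows "labelling a b f g h \<circ> Pair a = Pair 0 \<circ> f" "labelling a b f g h \<circ> Pair b = Pair 1 \<circ> g"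
    "labelling a b f g h \<circ> Pair c = Pair 2 \<circ> h"
  using labelling_simps[OF assms] by (simp_all add: fun_eq_iff)

lemma labelling_image:
  assumes C3: "is_C3 a b c"
    and img: "f ` pverts (H a) = {..<k}" "g ` pverts (H b) = {..<l}" "h ` pverts (H c) = {..<m}"
  shows "labelling a b f g h ` blow (pverts T) = pverts (C3_subst k R l S m U)"
proof -
  have blow: "blow (pverts T) = Pair a ` pverts (H a) \<union> Pair b ` pverts (H b) \<union> Pair c ` pverts (H c)"
    using C3 by (auto simp: is_C3_def)
  have times: "{i} \<times> X = Pair i ` X" for i :: nat and X :: "nat set"
    by auto
  show ?thesis
    unfolding blow pverts_C3_subst times img[symmetric]
    by (simp only: image_Un image_comp labelling_comp[OF C3])
qed

text \<open>The vertex labels need only be surjective, and only preimages of model arcs must be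
  arcs. Hence the actual parts may be larger than those of the model and have more arcs.\<close>

lemma splits_C3:
  assumes C3: "is_C3 a b c"
    and spl: "splits (pverts (C3_subst k R l S m U)) (parcs (C3_subst k R l S m U))"
    and img: "f ` pverts (H a) = {..<k}" "g ` pverts (H b) = {..<l}" "h ` pverts (H c) = {..<m}"
    and R: "\<And>x y. x \<in> pverts (H a) \<Longrightarrow> y \<in> pverts (H a) \<Longrightarrow> (f x, f y) \<in> R \<Longrightarrow> (x, y) \<in> parcs (H a)"
    and S: "\<And>x y. x \<in> pverts (H b) \<Longrightarrow> y \<in> pverts (H b) \<Longrightarrow> (g x, g y) \<in> S \<Longrightarrow> (x, y) \<in> parcs (H b)"
    and U: "\<And>x y. x \<in> pverts (H c) \<Longrightarrow> y \<in> pverts (H c) \<Longrightarrow> (h x, h y) \<in> U \<Longrightarrow> (x, y) \<in> parcs (H c)"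
  shows "splits (blow (pverts T)) E"
proof -
  have V: "pverts T = {a, b, c}" and A: "parcs T = {(a, b), (b, c), (c, a)}"
    using C3 by (auto simp: is_C3_def)
  obtain x y where xy: "x \<in> pverts (H a)" "y \<in> pverts (H b)"
    using ex_class V by blast
  let ?l = "labelling a b f g h"
  show ?thesis
  proof (rule splits_pullback[OF spl labelling_image[OF C3 img]])
    show "(0, f x) \<in> pverts (C3_subst k R l S m U)" "(1, g y) \<in> pverts (C3_subst k R l S m U)"
      using img xy by (auto simp: pverts_C3_subst)
    show "(0, f x) \<noteq> (1::nat, g y)"
      by simp
    fix v w assume v: "v \<in> blow (pverts T)" and w: "w \<in> blow (pverts T)"
      and arc: "(?l v, ?l w) \<in> parcs (C3_subst k R l S m U)"
    obtain u x u' y where vw: "v = (u, x)" "w = (u', y)" "x \<in> pverts (H u)" "y \<in> pverts (H u')"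
      using v w by blast
    have "u \<in> {a, b, c}" "u' \<in> {a, b, c}"
      using v w vw V by auto
    \<comment> \<open>Between different parts, all arcs exist in the direction of the triangle, and
      the model has none against it.\<close>
    then consider "u = a" "u' = a" | "u = b" "u' = b" | "u = c" "u' = c"
      | "(u, u') \<in> parcs T" | "(u', u) \<in> parcs T"
      using A by blast
    then show "(v, w) \<in> E"
    proof cases
      case 1
      then have "(f x, f y) \<in> R"
        using arc vw labelling_simps[OF C3] by (auto simp: parcs_C3_subst)
      then show ?thesis
        using 1 vw R V by (auto simp: composition_def)
    next
      case 2
      then have "(g x, g y) \<in> S"
        using arc vw labelling_simps[OF C3] by (auto simp: parcs_C3_subst)
      then show ?thesis
        using 2 vw S V by (auto simp: composition_def)
    next
      case 3
      then have "(h x, h y) \<in> U"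
        using arc vw labelling_simps[OF C3] by (auto simp: parcs_C3_subst)
      then show ?thesis
        using 3 vw U V by (auto simp: composition_def)
    next
      case 4
      then show ?thesis
        using vw by (simp add: cross_arc)
    next
      case 5
      then have False
        using arc vw labelling_simps[OF C3] A by (auto simp: parcs_C3_subst)
      then show ?thesis ..
    qed
  qed
qed

lemma iso_C3:
  assumes C3: "is_C3 a b c"
    and bij: "bij_betw f (pverts (H a)) {..<k}" "bij_betw g (pverts (H b)) {..<l}"
      "bij_betw h (pverts (H c)) {..<m}"
    and R: "map_prod f f ` parcs (H a) = R" and S: "map_prod g g ` parcs (H b) = S"
    and U: "map_prod h h ` parcs (H c) = U"
  shows "digraph_iso (with_proj (composition T H)) (with_proj (C3_subst k R l S m U))"
proof (rule digraph_isoI)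
  let ?l = "labelling a b f g h"
  have V: "pverts T = {a, b, c}" and A: "parcs T = {(a, b), (b, c), (c, a)}" and d: "distinct [a, b, c]"
    using C3 by (auto simp: is_C3_def)
  have img: "f ` pverts (H a) = {..<k}" "g ` pverts (H b) = {..<l}" "h ` pverts (H c) = {..<m}"
    using bij by (simp_all add: bij_betw_def)
  have "inj_on ?l (blow (pverts T))"
  proof (rule inj_onI)
    fix v w assume v: "v \<in> blow (pverts T)" and w: "w \<in> blow (pverts T)" and eq: "?l v = ?l w"
    obtain u x u' y where vw: "v = (u, x)" "w = (u', y)" "x \<in> pverts (H u)" "y \<in> pverts (H u')"
      using v w by blast
    have u: "u = a \<or> u = b \<or> u = c" "u' = a \<or> u' = b \<or> u' = c"
      using v w vw V by auto
    then have "u = u'"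
      using eq vw labelling_simps[OF C3] by auto
    moreover from this have "x = y"
      using u(1) eq vw labelling_simps[OF C3] bij[THEN bij_betw_imp_inj_on, THEN inj_onD, of x y]
      by auto
    ultimately show "v = w"
      using vw by simp
  qed
  then show "bij_betw ?l (pverts (composition T H)) (pverts (C3_subst k R l S m U))"
    using labelling_image[OF C3 img] by (simp add: bij_betw_def pverts_composition)
  show "E \<subseteq> pverts (composition T H) \<times> pverts (composition T H)"
    using arcs_E by (simp add: pverts_composition)
  \<comment> \<open>Written as a union of images and products, \<open>E\<close> can be mapped by the
    labelling term by term into the form of \<open>parcs_C3_subst\<close>.\<close>
  have E: "E = map_prod (Pair a) (Pair a) ` parcs (H a) \<union> map_prod (Pair b) (Pair b) ` parcs (H b) \<union>
      map_prod (Pair c) (Pair c) ` parcs (H c) \<union>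
      (Pair a ` pverts (H a)) \<times> (Pair b ` pverts (H b)) \<union>
      (Pair b ` pverts (H b)) \<times> (Pair c ` pverts (H c)) \<union>
      (Pair c ` pverts (H c)) \<times> (Pair a ` pverts (H a))"
    unfolding composition_def V A by (auto simp: image_iff)
  have pair: "(\<lambda>(x, y). ((i, x), (i, y))) = map_prod (Pair i) (Pair i)" for i :: nat
    by auto
  have times: "{i} \<times> X = Pair i ` X" for i :: nat and X :: "nat set"
    by auto
  show "parcs (C3_subst k R l S m U) = map_prod ?l ?l ` E"
    unfolding E parcs_C3_subst pair times R[symmetric] S[symmetric] U[symmetric] img[symmetric]
    by (simp only: image_Un map_prod_surj_on[OF refl refl] image_comp map_prod.comp
        labelling_comp[OF C3])
qed

lemma ex_arc_labelling:
  assumes u: "u \<in> pverts T" and k: "card (pverts (H u)) = k" and arc: "(p, q) \<in> parcs (H u)"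
  shows "\<exists>f. bij_betw f (pverts (H u)) {..<k} \<and> f p = 0 \<and> f q = (1::nat)"
  using arcs_H[OF u] no_loop_H[OF u] arc by (intro ex_bij_lessThan_pair[OF finite_H[OF u] k]) auto

text \<open>By injectivity \<open>(p, q)\<close> is the only pair with the given labels. Free labels
  \<open>i\<close> and \<open>j\<close> let the lemma also serve the reverse arc of a 2-cycle,
  labelled from 1 to 0.\<close>

lemma arc_labelling_inv:
  assumes "u \<in> pverts T" "(p, q) \<in> parcs (H u)" "bij_betw f (pverts (H u)) {..<k}" "f p = i" "f q = j"
    and "x \<in> pverts (H u)" "y \<in> pverts (H u)" "f x = i" "f y = j"
  shows "(x, y) \<in> parcs (H u)"
proof -
  have "p \<in> pverts (H u)" "q \<in> pverts (H u)"
    using arcs_H assms(1,2) by blast+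
  then have "x = p" "y = q"
    using assms(4-9) inj_onD[OF bij_betw_imp_inj_on[OF assms(3)]] by metis+
  then show ?thesis
    using assms(2) by simp
qed

lemma splits_if_card_4:
  assumes C3: "is_C3 a b c" and "card (pverts (H a)) \<ge> 4"
  shows "splits (blow (pverts T)) E"
proof -
  have V: "a \<in> pverts T" "b \<in> pverts T" "c \<in> pverts T"
    using C3 by (auto simp: is_C3_def)
  obtain f g h :: "'b \<Rightarrow> nat" where "f ` pverts (H a) = {..<4}" "g ` pverts (H b) = {..<2}" "h ` pverts (H c) = {..<2}"
    using ex_surj_lessThan[of 4 "pverts (H a)"] ex_surj_lessThan[of 2 "pverts (H b)"] ex_surj_lessThan[of 2 "pverts (H c)"] assms(2) card_H V
    by auto
  then show ?thesis
    by (rule splits_C3[OF C3 splits_C3_subst_4]) auto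
qed

lemma splits_if_card_3_3:
  assumes C3: "is_C3 a b c" and "card (pverts (H a)) \<ge> 3" "card (pverts (H b)) \<ge> 3"
  shows "splits (blow (pverts T)) E"
proof -
  have V: "a \<in> pverts T" "b \<in> pverts T" "c \<in> pverts T"
    using C3 by (auto simp: is_C3_def)
  obtain f g h :: "'b \<Rightarrow> nat" where "f ` pverts (H a) = {..<3}" "g ` pverts (H b) = {..<3}" "h ` pverts (H c) = {..<2}"
    using ex_surj_lessThan[of 3 "pverts (H a)"] ex_surj_lessThan[of 3 "pverts (H b)"] ex_surj_lessThan[of 2 "pverts (H c)"] assms(2,3) card_H V
    by auto
  then show ?thesis
    by (rule splits_C3[OF C3 splits_C3_subst_3_3]) auto
qed

text \<open>The part of size three fixes the rotation, so the three possible positions of an inner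
  arc need three separate models. The numbering \<open>e\<close> adapted to the arc replaces the
  arbitrary one on its part.\<close>

lemma splits_if_card_3_arc:
  assumes C3: "is_C3 a b c"
    and card: "card (pverts (H a)) = 3" "card (pverts (H b)) = 2" "card (pverts (H c)) = 2"
    and arc: "u \<in> pverts T" "parcs (H u) \<noteq> {}"
  shows "splits (blow (pverts T)) E"
proof -
  have V: "a \<in> pverts T" "b \<in> pverts T" "c \<in> pverts T"
    using C3 by (auto simp: is_C3_def)
  obtain f g h :: "'b \<Rightarrow> nat" where fgh: "f ` pverts (H a) = {..<3}" "g ` pverts (H b) = {..<2}" "h ` pverts (H c) = {..<2}"
    using ex_surj_lessThan[of 3 "pverts (H a)"] ex_surj_lessThan[of 2 "pverts (H b)"] ex_surj_lessThan[of 2 "pverts (H c)"] card by auto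
  obtain p q where pq: "(p, q) \<in> parcs (H u)"
    using arc(2) by auto
  obtain e :: "'b \<Rightarrow> nat" where e: "bij_betw e (pverts (H u)) {..<card (pverts (H u))}" "e p = 0" "e q = 1"
    using ex_arc_labelling[OF arc(1) refl pq] by blast
  note inv = arc_labelling_inv[OF arc(1) pq e]
  have img: "e ` pverts (H u) = {..<card (pverts (H u))}"
    using e(1) by (rule bij_betw_imp_surj_on)
  consider "u = a" | "u = b" | "u = c"
    using arc(1) C3 by (auto simp: is_C3_def)
  then show ?thesis
  proof cases
    case 1
    then show ?thesis
      using img card inv by (intro splits_C3[OF C3 splits_C3_subst_3_arc0 _ fgh(2,3), of e]) auto
  next
    case 2
    then show ?thesis
      using img card inv by (intro splits_C3[OF C3 splits_C3_subst_3_arc1 fgh(1) _ fgh(3), of e]) auto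
  next
    case 3
    then show ?thesis
      using img card inv by (intro splits_C3[OF C3 splits_C3_subst_3_arc2 fgh(1,2), of e]) auto
  qed
qed

lemma splits_if_two_arcs:
  assumes C3: "is_C3 a b c" and card: "card (pverts (H a)) = 2" "card (pverts (H b)) = 2"
    and arcs: "parcs (H a) \<noteq> {}" "parcs (H b) \<noteq> {}"
  shows "splits (blow (pverts T)) E"
proof -
  have V: "a \<in> pverts T" "b \<in> pverts T" "c \<in> pverts T"
    using C3 by (auto simp: is_C3_def)
  obtain p q r s where pq: "(p, q) \<in> parcs (H a)" and rs: "(r, s) \<in> parcs (H b)"
    using arcs by auto
  obtain f g :: "'b \<Rightarrow> nat" where f: "bij_betw f (pverts (H a)) {..<2}" "f p = 0" "f q = 1"
    and g: "bij_betw g (pverts (H b)) {..<2}" "g r = 0" "g s = 1"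
    using ex_arc_labelling[OF V(1) card(1) pq] ex_arc_labelling[OF V(2) card(2) rs] by blast
  obtain h :: "'b \<Rightarrow> nat" where h: "h ` pverts (H c) = {..<2}"
    using ex_surj_lessThan[of 2 "pverts (H c)"] card_H[OF V(3)] by auto
  show ?thesis
    using arc_labelling_inv[OF V(1) pq f] arc_labelling_inv[OF V(2) rs g]
    by (intro splits_C3[OF C3 splits_C3_subst_two_arcs bij_betw_imp_surj_on[OF f(1)]
        bij_betw_imp_surj_on[OF g(1)] h]) auto
qed

lemma splits_if_2cycle:
  assumes C3: "is_C3 a b c" and card: "card (pverts (H a)) = 2"
    and arcs: "(p, q) \<in> parcs (H a)" "(q, p) \<in> parcs (H a)"
  shows "splits (blow (pverts T)) E"
proof -
  have V: "a \<in> pverts T" "b \<in> pverts T" "c \<in> pverts T"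
    using C3 by (auto simp: is_C3_def)
  obtain f :: "'b \<Rightarrow> nat" where f: "bij_betw f (pverts (H a)) {..<2}" "f p = 0" "f q = 1"
    using ex_arc_labelling[OF V(1) card arcs(1)] by blast
  obtain g h :: "'b \<Rightarrow> nat" where gh: "g ` pverts (H b) = {..<2}" "h ` pverts (H c) = {..<2}"
    using ex_surj_lessThan[of 2 "pverts (H b)"] ex_surj_lessThan[of 2 "pverts (H c)"] card_H V by auto
  show ?thesis
    using arc_labelling_inv[OF V(1) arcs(1) f] arc_labelling_inv[OF V(1) arcs(2) f(1,3,2)]
    by (intro splits_C3[OF C3 splits_C3_subst_2cycle bij_betw_imp_surj_on[OF f(1)] gh]) auto
qed

section \<open>Identification of the exceptions\<close>

abbreviation exceptional :: bool where
  "exceptional \<equiv>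
     digraph_iso (with_proj (composition T H)) (with_proj (C3_subst 2 {} 2 {} 2 {})) \<or>
     digraph_iso (with_proj (composition T H)) (with_proj (C3_subst 2 {(0, 1)} 2 {} 2 {})) \<or>
     digraph_iso (with_proj (composition T H)) (with_proj (C3_subst 2 {} 2 {} 3 {}))"

lemma exceptional_if_no_arcs:
  assumes C3: "is_C3 a b c"
    and card: "card (pverts (H a)) = 2" "card (pverts (H b)) = 2" "card (pverts (H c)) \<in> {2, 3}"
    and none: "\<And>u. u \<in> pverts T \<Longrightarrow> parcs (H u) = {}"
  shows exceptional
proof -
  have V: "parcs (H a) = {}" "parcs (H b) = {}" "parcs (H c) = {}"
    using C3 none by (auto simp: is_C3_def)
  obtain f g h :: "'b \<Rightarrow> nat" where "bij_betw f (pverts (H a)) {..<2}" "bij_betw g (pverts (H b)) {..<2}"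
      "bij_betw h (pverts (H c)) {..<card (pverts (H c))}"
    using ex_bij_lessThan[OF card(1)] ex_bij_lessThan[OF card(2)] ex_bij_lessThan[of "pverts (H c)", OF refl] card(3)
    by auto
  then have "digraph_iso (with_proj (composition T H)) (with_proj (C3_subst 2 {} 2 {} (card (pverts (H c))) {}))"
    using V by (intro iso_C3[OF C3]) auto
  then show ?thesis
    using card(3) by auto
qed

lemma exceptional_if_arc:
  assumes C3: "is_C3 a b c" and ns: "\<not> splits (blow (pverts T)) E"
    and card: "card (pverts (H a)) = 2" "card (pverts (H b)) = 2" "card (pverts (H c)) = 2"
    and arc: "parcs (H a) \<noteq> {}"
  shows exceptional
proof -
  have V: "a \<in> pverts T" "b \<in> pverts T" "c \<in> pverts T"
    using C3 by (auto simp: is_C3_def)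
  \<comment> \<open>Two cyclically adjacent parts with arcs would split: \<open>a\<close> with
    \<open>b\<close> directly, and \<open>c\<close> with \<open>a\<close> after two
    rotations.\<close>
  have none: "parcs (H b) = {}" "parcs (H c) = {}"
    using ns arc card splits_if_two_arcs[OF C3] splits_if_two_arcs[OF is_C3_rotate[OF is_C3_rotate[OF C3]]]
    by auto
  obtain p q where pq: "(p, q) \<in> parcs (H a)"
    using arc by auto
  then have pq': "p \<in> pverts (H a)" "q \<in> pverts (H a)" "p \<noteq> q"
    using arcs_H[OF V(1)] no_loop_H[OF V(1)] by auto
  then have "{p, q} = pverts (H a)"
    using finite_H[OF V(1)] card(1) by (intro card_subset_eq) auto
  then have "parcs (H a) \<subseteq> {p, q} \<times> {p, q}"
    using arcs_H[OF V(1)] by simp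
  moreover have "(q, p) \<notin> parcs (H a)"
    using ns splits_if_2cycle[OF C3 card(1) pq] by blast
  moreover have "(p, p) \<notin> parcs (H a)" "(q, q) \<notin> parcs (H a)"
    using no_loop_H[OF V(1)] by auto
  ultimately have single: "parcs (H a) = {(p, q)}"
    using pq by auto
  obtain f g h :: "'b \<Rightarrow> nat" where "bij_betw f (pverts (H a)) {..<2}" "f p = 0" "f q = 1"
      "bij_betw g (pverts (H b)) {..<2}" "bij_betw h (pverts (H c)) {..<2}"
    using ex_arc_labelling[OF V(1) card(1) pq] ex_bij_lessThan[OF card(2)] ex_bij_lessThan[OF card(3)] by auto
  then have "digraph_iso (with_proj (composition T H)) (with_proj (C3_subst 2 {(0, 1)} 2 {} 2 {}))"
    using none single by (intro iso_C3[OF C3]) auto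
  then show ?thesis
    by blast
qed

text \<open>A fourth vertex, a second part of size three, or any inner arc would give a
  decomposition. One rotation then moves the part of size three to the last position, where the
  exception has it.\<close>

lemma exceptional_if_card_3:
  assumes C3: "is_C3 a b c" and ns: "\<not> splits (blow (pverts T)) E" and card: "card (pverts (H a)) \<ge> 3"
  shows exceptional
proof -
  have V: "a \<in> pverts T" "b \<in> pverts T" "c \<in> pverts T"
    using C3 by (auto simp: is_C3_def)
  note C3' = is_C3_rotate[OF C3] is_C3_rotate[OF is_C3_rotate[OF C3]]
  have a: "card (pverts (H a)) = 3"
    using ns card splits_if_card_4[OF C3] by force
  moreover have b: "card (pverts (H b)) = 2"
    using ns card splits_if_card_3_3[OF C3] card_H[OF V(2)] by force
  moreover have c: "card (pverts (H c)) = 2"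
    using ns card splits_if_card_3_3[OF C3'(2)] card_H[OF V(3)] by force
  ultimately have "parcs (H u) = {}" if "u \<in> pverts T" for u
    using ns splits_if_card_3_arc[OF C3] that by blast
  then show ?thesis
    using a b c by (intro exceptional_if_no_arcs[OF C3'(1)]) auto
qed

lemma exceptional_if_not_splits:
  assumes C3: "is_C3 a b c" and ns: "\<not> splits (blow (pverts T)) E"
  shows exceptional
proof -
  have V: "pverts T = {a, b, c}"
    using C3 by (simp add: is_C3_def)
  note C3' = is_C3_rotate[OF C3] is_C3_rotate[OF is_C3_rotate[OF C3]]
  show ?thesis
  proof (cases "\<exists>u \<in> pverts T. card (pverts (H u)) \<ge> 3")
    case True
    then show ?thesis
      unfolding V using exceptional_if_card_3[OF _ ns] C3 C3' by blast
  next
    case False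
    then have "card (pverts (H u)) = 2" if "u \<in> pverts T" for u
      using card_H[OF that] that by force
    then have card: "card (pverts (H a)) = 2" "card (pverts (H b)) = 2" "card (pverts (H c)) = 2"
      unfolding V by simp_all
    show ?thesis
    proof (cases "\<exists>u \<in> pverts T. parcs (H u) \<noteq> {}")
      case True
      then consider "parcs (H a) \<noteq> {}" | "parcs (H b) \<noteq> {}" | "parcs (H c) \<noteq> {}"
        unfolding V by blast
      then show ?thesis
        using exceptional_if_arc[OF C3 ns] exceptional_if_arc[OF C3'(1) ns]
          exceptional_if_arc[OF C3'(2) ns] card by cases simp_all
    next
      case False
      then show ?thesis
        using card by (intro exceptional_if_no_arcs[OF C3]) auto
    qed
  qed
qed

lemma not_splits_if_exceptional:
  assumes ex: exceptional and card: "card (pverts T) \<ge> 2"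
  shows "\<not> splits (blow (pverts T)) E"
proof
  assume "splits (blow (pverts T)) E"
  then have spl: "splits (pverts (composition T H)) E"
    by (simp add: pverts_composition)
  obtain u where u: "u \<in> pverts T"
    using card by fastforce
  obtain x y where "x \<in> pverts (H u)" "x = rep u" "y \<in> pverts (H u)" "y \<noteq> rep u"
    using ex_class[OF u, of True] ex_class[OF u, of False] by auto
  then have pq: "(u, x) \<in> pverts (composition T H)" "(u, y) \<in> pverts (composition T H)" "(u, x) \<noteq> (u, y)"
    using u by (simp_all add: pverts_composition)
  \<comment> \<open>The arcless exception is a spanning subdigraph of the one with an inner arc, so
    its indecomposability follows by monotonicity.\<close>
  have "splits (pverts (C3_subst 2 {(0, 1)} 2 {} 2 {})) (parcs (C3_subst 2 {(0, 1)} 2 {} 2 {}))"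
    if "splits (pverts (C3_subst 2 {} 2 {} 2 {})) (parcs (C3_subst 2 {} 2 {} 2 {}))"
  proof -
    have "parcs (C3_subst 2 {} 2 {} 2 {}) \<subseteq> parcs (C3_subst 2 {(0, 1)} 2 {} 2 {})"
      unfolding parcs_C3_subst by auto
    then show ?thesis
      using splits_mono[OF that] unfolding pverts_C3_subst by blast
  qed
  then show False
    using ex splits_iso[OF _ spl pq] not_splits_C3_subst_arc not_splits_C3_subst_3 by metis
qed

end

theorem theorem2p3:
  fixes T :: "'a pair_pre_digraph" and H :: "'a \<Rightarrow> 'b pair_pre_digraph"
    and Q :: "('a \<times> 'b) pair_pre_digraph"
  assumes "pair_digraph T"
    and "strongly_connected (with_proj T)"
    and "semicomplete T"
    and "card (pverts T) \<ge> 2"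
    and "\<And>u. u \<in> pverts T \<Longrightarrow> pair_digraph (H u)"
    and "\<And>u. u \<in> pverts T \<Longrightarrow> card (pverts (H u)) \<ge> 2"
    and "Q = composition T H"
  shows "good_decomposition Q \<longleftrightarrow>
    \<not> (digraph_iso (with_proj Q)
         (with_proj (composition (dicycle 3) ((!) [arcless 2, arcless 2, arcless 2]))) \<or>
       digraph_iso (with_proj Q)
         (with_proj (composition (dicycle 3) ((!) [dipath 2, arcless 2, arcless 2]))) \<or>
       digraph_iso (with_proj Q)
         (with_proj (composition (dicycle 3) ((!) [arcless 2, arcless 2, arcless 3]))))"
proof -
  interpret T: pair_digraph T by (rule assms(1))
  have "parcs T \<subseteq> pverts T \<times> pverts T"
    using T.in_arcsD1 T.in_arcsD2 by auto
  moreover have "\<lparr>pverts = pverts T, parcs = parcs T\<rparr> = T"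
    by (cases T) simp
  ultimately have "strong (pverts T) (parcs T)"
    using assms(2) strongly_connected_iff_strong by metis
  then interpret blow_up T H
    using assms(1,5,6) by (intro blow_up.intro)
  have "dipath 2 = \<lparr>pverts = {..<2}, parcs = {(0, 1)}\<rparr>"
    by (auto simp: dipath_def)
  then have exc: "composition (dicycle 3) ((!) [arcless 2, arcless 2, arcless 2]) = C3_subst 2 {} 2 {} 2 {}"
      "composition (dicycle 3) ((!) [dipath 2, arcless 2, arcless 2]) = C3_subst 2 {(0, 1)} 2 {} 2 {}"
      "composition (dicycle 3) ((!) [arcless 2, arcless 2, arcless 3]) = C3_subst 2 {} 2 {} 3 {}"
    by (simp_all add: C3_subst_def arcless_def)
  \<comment> \<open>Non-splitting forces the triangle and then an exceptional composition;
    conversely, the exceptions do not split.\<close>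
  show ?thesis
    unfolding assms(7) good_iff exc
    using is_C3_if_not_splits[OF assms(3,4)] exceptional_if_not_splits not_splits_if_exceptional[OF _ assms(4)]
    by blast
qed

end
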